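(* Let $n$ be a positive integer and let $z\in\mathbb{C}\setminus\big(\mathbb{Z}^{-}\cup\{0,1,\ldots,n-1\}\big)$, where $\mathbb{Z}^-$ denotes the set of negative integers. Then $$K(z)=K(z-n)+\big(Q_n(z)-1\big)\cdot\Gamma(z+1)$$ and $$K(z)=K(z-n)+R_n(z)\cdot\Gamma(z+1).$$
   Context: $\Gamma$ is the gamma function. Kurepa's function $K$ is defined for $\operatorname{Re} z>0$ by $$K(z)=\int_0^\infty e^{-t}\,\frac{t^z-1}{t-1}\,dt ,$$ and extended to a meromorphic function on $\mathbb{C}$ by means of the functional equation $K(z)-K(z-1)=\Gamma(z)$, i.e. $K(z-1)=K(z)-\Gamma(z)$ (its poles are simple and located at $z=-1$ and $z=-m$, $m\ge 3$; at $z=0$ and $z=-2$ it takes the value of its analytic continuation). The rational functions $Q_n(z)$, $R_n(z)$ ($n\ge1$, $z\in\mathbb{C}\setminus\{0,1,\ldots,n-1\}$) are defined by $$Q_1(z)=\frac{z+1}{z},\quad Q_2(z)=\frac{z}{z-1},\quad R_1(z)=\frac1z,\quad R_2(z)=\frac1{z-1},$$ and, for $n\ge 3$, by the recurrences $$Q_n(z)=\frac{z-n+2}{z-n+1}Q_{n-1}(z)-\frac{1}{z-n+1}Q_{n-2}(z),\qquad R_n(z)=\frac{z-n+2}{z-n+1}R_{n-1}(z)-\frac{1}{z-n+1}R_{n-2}(z).$$ *)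

theory Defs
  imports "HOL-Complex_Analysis.Complex_Analysis"
begin

definition kurepa_integral :: "complex \<Rightarrow> complex" where
  "kurepa_integral z =
     integral {0..} (\<lambda>t::real. of_real (exp (- t)) * ((of_real t powr z - 1) / (of_real t - 1)))"

(* Extension to the left half-plane by the functional equation K(z - 1) = K(z) - Gamma(z), read
   with z + 1 for z. As the library sets Gamma to 0 at its poles, the values of this function at
   negative integers carry no meaning; kurepa below corrects them. *)
function kurepa_ext :: "complex \<Rightarrow> complex" where
  "kurepa_ext z = (if Re z > 0 then kurepa_integral z else kurepa_ext (z + 1) - Gamma (z + 1))"
  by auto
termination
proof (relation "Wellfounded.measure (\<lambda>z. nat \<lceil>1 - Re z\<rceil>)")
  fix z :: complex
  assume "\<not> Re z > 0"
  then have "\<lceil>1 - Re z\<rceil> > 0" by simp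
  moreover have "\<lceil>1 - Re (z + 1)\<rceil> = \<lceil>1 - Re z\<rceil> - 1"
    using ceiling_diff_one[of "1 - Re z"] by (simp add: algebra_simps)
  ultimately show "(z + 1, z) \<in> Wellfounded.measure (\<lambda>z. nat \<lceil>1 - Re z\<rceil>)" by simp
qed simp

declare kurepa_ext.simps [simp del]

(* remove_sings takes the limit wherever it exists, i.e. the value of the analytic continuation
   (in particular at 0 and -2), and 0 at the poles. *)
definition kurepa :: "complex \<Rightarrow> complex" where
  "kurepa = remove_sings kurepa_ext"

(* Only indices n >= 1 are meaningful. The clauses for index 0 are the values for which the
   recurrences also hold at n = 2. *)
fun kurepa_Q :: "nat \<Rightarrow> complex \<Rightarrow> complex" where
  "kurepa_Q 0 z = 1"
| "kurepa_Q (Suc 0) z = (z + 1) / z"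
| "kurepa_Q (Suc (Suc 0)) z = z / (z - 1)"
| "kurepa_Q (Suc (Suc (Suc m))) z =
     (let n = of_nat (Suc (Suc (Suc m)))
      in (z - n + 2) / (z - n + 1) * kurepa_Q (Suc (Suc m)) z
         - 1 / (z - n + 1) * kurepa_Q (Suc m) z)"

fun kurepa_R :: "nat \<Rightarrow> complex \<Rightarrow> complex" where
  "kurepa_R 0 z = 0"
| "kurepa_R (Suc 0) z = 1 / z"
| "kurepa_R (Suc (Suc 0)) z = 1 / (z - 1)"
| "kurepa_R (Suc (Suc (Suc m))) z =
     (let n = of_nat (Suc (Suc (Suc m)))
      in (z - n + 2) / (z - n + 1) * kurepa_R (Suc (Suc m)) z
         - 1 / (z - n + 1) * kurepa_R (Suc m) z)"

end

theory Submission imports Defs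
begin

text \<open>
  Integrating \<open>(t^z - t^(z-1)) / (t - 1) = t^(z-1)\<close> against \<open>e^(-t)\<close> gives the functional equation of
  \<open>K\<close> for \<open>Re z > 1\<close>, so that the extension satisfies it everywhere. Iterating it \<open>n\<close> times
  yields \<open>K(z) - K(z - n) = \<Gamma>(z) + \<dots> + \<Gamma>(z - n + 1)\<close>, and the recurrence says exactly that
  consecutive differences of \<open>R\<^sub>n(z)\<close> are \<open>\<Gamma>(z - n) / \<Gamma>(z + 1)\<close>, while \<open>Q\<^sub>n = R\<^sub>n + 1\<close>.
  The values of \<open>K\<close> are defined as limits, so one also needs continuity of the extension away
  from the negative integers; this matters at \<open>0\<close>, on the boundary of the half-plane of
  convergence, and comes from dominated convergence.
\<close>

section \<open>Integrability of the integrand\<close>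

definition kurepa_integrand :: "complex \<Rightarrow> real \<Rightarrow> complex" where
  "kurepa_integrand z t = of_real (exp (- t)) * ((of_real t powr z - 1) / (of_real t - 1))"

lemma kurepa_integral_eq: "kurepa_integral z = integral {0..} (kurepa_integrand z)"
  by (simp add: kurepa_integral_def kurepa_integrand_def [abs_def])

text \<open>Mean value inequality on a half-plane containing \<open>0\<close> and \<open>w\<close>,
  where \<open>exp\<close> bounds its own derivative. With \<open>w = z * ln t\<close> it controls
  the numerator \<open>t powr z - 1\<close> near \<open>t = 1\<close>.\<close>

lemma norm_exp_minus_1_le:
  fixes w :: complex
  shows "norm (exp w - 1) \<le> max 1 (exp (Re w)) * norm w"
proof -
  have "norm (exp w - exp 0) \<le> max 1 (exp (Re w)) * norm (w - 0)"
  proof (rule field_differentiable_bound[where f' = exp])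
    show "convex {u. Re u \<le> max 0 (Re w)}"
      by (rule convex_halfspace_Re_le)
  next
    fix u assume "u \<in> {u. Re u \<le> max 0 (Re w)}"
    then show "norm (exp u) \<le> max 1 (exp (Re w))"
      by (auto simp: max_def split: if_splits)
  qed (auto intro!: derivative_eq_intros)
  then show ?thesis by simp
qed

text \<open>The majorant depends on \<open>z\<close> only through \<open>M\<close>, as dominated
  convergence requires. For \<open>t \<le> 1/2\<close> the denominator is at least
  \<open>1/2\<close>, which gives the constant 4; for larger \<open>t\<close> a bound on
  \<open>\<bar>ln t\<bar>\<close> by a multiple of \<open>\<bar>t - 1\<bar>\<close> cancels the
  denominator.\<close>

lemma norm_kurepa_integrand_le:
  assumes z: "Re z > 0" "norm z \<le> M" and t: "t \<ge> 0"
  shows "norm (kurepa_integrand z t) \<le> exp (- t) * ((2 * M + 4) * (1 + t powr M))"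
proof -
  have M: "M \<ge> 0" using z(2) norm_ge_zero[of z] by linarith
  have ReM: "Re z \<le> M" using z(2) complex_Re_le_cmod[of z] by linarith
  define q where "q = norm ((of_real t powr z - 1) / (of_real t - 1 :: complex))"
  have n1: "norm (of_real t - 1 :: complex) = \<bar>t - 1\<bar>"
    by (metis norm_of_real of_real_1 of_real_diff)
  have q: "q = norm (of_real t powr z - 1) / \<bar>t - 1\<bar>"
    unfolding q_def by (simp only: norm_divide n1)
  have np: "norm (of_real t powr z :: complex) = t powr Re z"
    using t by (simp add: norm_powr_real_powr)
  have E: "norm (of_real t powr z - 1) \<le> max 1 (t powr Re z) * (norm z * \<bar>ln t\<bar>)" if "t > 0"
    using norm_exp_minus_1_le[of "z * of_real (ln t)"] that
    by (simp add: powr_def Ln_of_real norm_mult mult.commute)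
  have "q \<le> (2 * M + 4) * (1 + t powr M)"
  proof -
    consider "t \<le> 1/2" | "1/2 < t" "t < 1" | "t = 1" | "t > 1" by linarith
    then show ?thesis
    proof cases
      case 1
      have "t powr Re z \<le> 1" using 1 t z by (simp add: powr_le1)
      then have "norm (of_real t powr z - 1) \<le> 2"
        using norm_triangle_ineq4[of "of_real t powr z" 1] np by simp
      then have "q \<le> 2 / (1/2)"
        unfolding q using 1 by (intro frac_le) auto
      also have "\<dots> \<le> (2 * M + 4) * 1" using M by simp
      also have "\<dots> \<le> (2 * M + 4) * (1 + t powr M)" using M by (intro mult_left_mono) auto
      finally show ?thesis .
    next
      case 2
      have a: "t powr Re z \<le> 1" using 2 z by (simp add: powr_le1)
      \<comment> \<open>The inequality \<open>ln x \<le> x - 1\<close> is applied at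
        \<open>x = 1 / t < 2\<close>; the resulting factor 2 is the one in
        \<open>2 * M\<close>.\<close>
      have "- ln t = ln (1 / t)" using 2 by (simp add: ln_div)
      also have "\<dots> \<le> 1 / t - 1" using 2 by (intro ln_le_minus_one) simp
      also have "\<dots> = (1 - t) * (1 / t)" using 2 by (simp add: field_simps)
      also have "\<dots> \<le> (1 - t) * 2" using 2 by (intro mult_left_mono) (auto simp: field_simps)
      finally have l: "\<bar>ln t\<bar> \<le> 2 * (1 - t)" using 2 by simp
      have "norm (of_real t powr z - 1) \<le> norm z * \<bar>ln t\<bar>"
        using E 2 a by (simp add: max_def split: if_splits)
      also have "\<dots> \<le> M * (2 * (1 - t))" using z l M by (intro mult_mono) auto
      finally have "q \<le> 2 * M" unfolding q using 2 by (simp add: field_simps)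
      also have "\<dots> \<le> (2 * M + 4) * 1" by simp
      also have "\<dots> \<le> (2 * M + 4) * (1 + t powr M)" using M by (intro mult_left_mono) auto
      finally show ?thesis .
    next
      \<comment> \<open>Division by zero makes the quotient \<open>0\<close> here.\<close>
      case 3
      then show ?thesis using M by (simp add: q)
    next
      case 4
      have a: "1 \<le> t powr Re z" using 4 z by (simp add: ge_one_powr_ge_zero)
      have b: "t powr Re z \<le> t powr M" using 4 ReM by (intro powr_mono) auto
      have l: "\<bar>ln t\<bar> \<le> t - 1" using 4 ln_le_minus_one[of t] by simp
      have "norm (of_real t powr z - 1) \<le> t powr Re z * (norm z * \<bar>ln t\<bar>)"
        using E 4 a by (simp add: max_def split: if_splits)
      also have "\<dots> \<le> t powr M * (M * (t - 1))" using z l M b by (intro mult_mono) auto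
      finally have "q \<le> t powr M * M" unfolding q using 4 by (simp add: field_simps)
      also have "\<dots> \<le> (1 + t powr M) * (2 * M + 4)" using M by (intro mult_mono) auto
      finally show ?thesis by (simp add: mult.commute)
    qed
  qed
  then have "exp (- t) * q \<le> exp (- t) * ((2 * M + 4) * (1 + t powr M))"
    by (rule mult_left_mono) simp
  moreover have "norm (kurepa_integrand z t) = exp (- t) * q"
    unfolding kurepa_integrand_def norm_mult q_def norm_of_real by simp
  ultimately show ?thesis by simp
qed

text \<open>Up to a constant factor, this is an exponential integral plus the Gamma integral at
  \<open>M + 1\<close>.\<close>

lemma kurepa_bound_integrable:
  fixes M :: real
  assumes "M > 0"
  shows "(\<lambda>t. exp (- t) * ((2 * M + 4) * (1 + t powr M))) integrable_on {0..}"
proof -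
  have "(\<lambda>t::real. exp (- 1 * t)) integrable_on {0..}"
    by (rule integrable_on_exp_minus_to_infinity) simp
  moreover have "(\<lambda>t. t powr (M + 1 - 1) / exp t) integrable_on {0..}"
    using Gamma_integral_real[of "M + 1"] assms by (intro has_integral_integrable) auto
  ultimately have "(\<lambda>t. (2 * M + 4) * (exp (- 1 * t) + t powr (M + 1 - 1) / exp t)) integrable_on {0..}"
    by (intro integrable_on_mult_right integrable_add)
  then show ?thesis by (simp add: algebra_simps exp_minus divide_inverse)
qed

lemma kurepa_integrand_integrable:
  assumes "Re z > 0"
  shows "kurepa_integrand z integrable_on {0..}"
proof -
  \<comment> \<open>On \<open>S\<close> the integrand is continuous, hence measurable; the two
    points left out do not affect integrability.\<close>
  define S :: "real set" where "S = {0<..} - {1}"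
  have eq: "{0..} = insert 0 (insert 1 S)" by (auto simp: S_def)
  define M where "M = norm z"
  have M: "M > 0" using assms by (auto simp: M_def)
  have S: "S \<in> sets lebesgue" by (simp add: S_def)
  have "continuous_on S (kurepa_integrand z)"
    unfolding kurepa_integrand_def [abs_def] S_def
    by (intro continuous_intros) (auto simp: complex_eq_iff)
  then have "kurepa_integrand z \<in> borel_measurable (lebesgue_on S)"
    using S by (rule continuous_imp_measurable_on_sets_lebesgue)
  then have "kurepa_integrand z integrable_on S"
  proof (rule measurable_bounded_by_integrable_imp_integrable)
    show "(\<lambda>t. exp (- t) * ((2 * M + 4) * (1 + t powr M))) integrable_on S"
      using kurepa_bound_integrable[OF M] unfolding eq integrable_on_insert_iff .
  next
    fix t assume "t \<in> S"
    then show "norm (kurepa_integrand z t) \<le> exp (- t) * ((2 * M + 4) * (1 + t powr M))"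
      using assms by (intro norm_kurepa_integrand_le) (auto simp: S_def M_def)
  qed (rule S)
  then show ?thesis unfolding eq integrable_on_insert_iff .
qed

section \<open>Continuity and functional equation of the integral\<close>

lemma isCont_kurepa_integral:
  assumes "Re z > 0"
  shows "isCont kurepa_integral z"
proof -
  define M where "M = norm z + 1"
  have M: "M > 0" by (simp add: M_def add_nonneg_pos)
  \<comment> \<open>Intersecting with a ball gives all exponents in \<open>S\<close> the same
    majorant.\<close>
  define S where "S = {w. Re w > 0} \<inter> ball 0 M"
  have "open S"
    unfolding S_def by (intro open_Int open_halfspace_Re_gt open_ball)
  moreover have "z \<in> S" using assms by (simp add: S_def M_def)
  moreover have "continuous_on S kurepa_integral"
  proof (rule continuous_on_sequentiallyI)
    fix u a assume u: "\<forall>n. u n \<in> S" and a: "a \<in> S" and lim: "u \<longlonglongrightarrow> a"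
    show "(\<lambda>n. kurepa_integral (u n)) \<longlonglongrightarrow> kurepa_integral a"
      unfolding kurepa_integral_eq
    proof (rule dominated_convergence(2))
      show "kurepa_integrand (u k) integrable_on {0..}" for k
        using u by (intro kurepa_integrand_integrable) (auto simp: S_def)
      show "(\<lambda>t. exp (- t) * ((2 * M + 4) * (1 + t powr M))) integrable_on {0..}"
        by (rule kurepa_bound_integrable[OF M])
      show "norm (kurepa_integrand (u k) t) \<le> exp (- t) * ((2 * M + 4) * (1 + t powr M))"
        if "t \<in> {0..}" for k t
        using u that by (intro norm_kurepa_integrand_le) (auto simp: S_def less_imp_le)
      show "(\<lambda>k. kurepa_integrand (u k) t) \<longlonglongrightarrow> kurepa_integrand a t" if "t \<in> {0..}" for t
      \<comment> \<open>At these points the integrand has a value independent of the exponent: 1 at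
        \<open>t = 0\<close>, and 0 at \<open>t = 1\<close> by division by zero.\<close>
      proof (cases "t = 0 \<or> t = 1")
        case True
        then show ?thesis by (auto simp: kurepa_integrand_def)
      next
        case False
        then have "t > 0" "complex_of_real t - 1 \<noteq> 0" using that by (auto simp: complex_eq_iff)
        then show ?thesis
          unfolding kurepa_integrand_def
          by (intro tendsto_intros tendsto_powr_complex lim) (auto simp: complex_nonpos_Reals_iff)
      qed
    qed
  qed
  ultimately show ?thesis by (simp add: continuous_on_eq_continuous_at)
qed

lemma kurepa_integral_plus_1:
  assumes "Re z > 0"
  shows "kurepa_integral (z + 1) = kurepa_integral z + Gamma (z + 1)"
proof -
  have "((\<lambda>t. of_real t powr (z + 1 - 1) / of_real (exp t)) has_integral Gamma (z + 1)) {0..}"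
    using assms by (intro Gamma_integral_complex) simp
  then have "((\<lambda>t. kurepa_integrand z t + of_real t powr (z + 1 - 1) / of_real (exp t))
      has_integral kurepa_integral z + Gamma (z + 1)) {0..}"
    unfolding kurepa_integral_eq
    by (intro has_integral_add integrable_integral kurepa_integrand_integrable assms)
  then have "(kurepa_integrand (z + 1) has_integral kurepa_integral z + Gamma (z + 1)) {0..}"
  \<comment> \<open>The pointwise identity fails at \<open>t = 1\<close>: both quotients are
    \<open>0\<close> there, but the Gamma integrand is not.\<close>
  proof (rule has_integral_spike_finite[rotated 2, where S = "{1}"])
    fix t :: real assume t: "t \<in> {0..} - {1}"
    then have "complex_of_real t - 1 \<noteq> 0" by (auto simp: complex_eq_iff)
    moreover have "of_real t powr (z + 1) = of_real t powr z * complex_of_real t"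
      by (auto simp: powr_add)
    ultimately have "(of_real t powr (z + 1) - 1) / (of_real t - 1)
        = (of_real t powr z - 1) / (of_real t - 1) + complex_of_real t powr z"
      by (simp add: divide_simps) (simp add: algebra_simps)
    moreover have "of_real t powr (z + 1 - 1) / of_real (exp t)
        = complex_of_real (exp (- t)) * of_real t powr z"
      by (simp add: exp_minus divide_inverse)
    ultimately show "kurepa_integrand (z + 1) t
        = kurepa_integrand z t + of_real t powr (z + 1 - 1) / of_real (exp t)"
      unfolding kurepa_integrand_def by (simp only: distrib_left)
  qed simp
  then show ?thesis by (simp add: kurepa_integral_eq integral_unique)
qed

section \<open>The extension and its continuity\<close>

text \<open>For \<open>Re z \<le> 0\<close> this is the defining recursion, including its convention
  for \<open>Gamma\<close> at the poles.\<close>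

lemma kurepa_ext_plus_1: "kurepa_ext (z + 1) = kurepa_ext z + Gamma (z + 1)"
proof (cases "Re z > 0")
  case True
  then show ?thesis
    using kurepa_integral_plus_1[OF True] kurepa_ext.simps[of z] kurepa_ext.simps[of "z + 1"]
    by simp
next
  case False
  then show ?thesis using kurepa_ext.simps[of z] by simp
qed

text \<open>Each induction step widens the half-plane by one unit: continuity at \<open>z\<close>
  follows from continuity at \<open>z + 1\<close> of both \<open>kurepa_ext\<close> and
  \<open>Gamma\<close>. The point \<open>0\<close> is reached from \<open>1\<close>.\<close>

lemma isCont_kurepa_ext_strip:
  assumes "Re z > - real m" "z \<notin> of_int ` {k. k < 0}"
  shows "isCont kurepa_ext z"
  using assms
proof (induction m arbitrary: z)
  case 0
  have "eventually (\<lambda>w. w \<in> {w. Re w > 0}) (nhds z)"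
    using 0 by (intro eventually_nhds_in_open open_halfspace_Re_gt) auto
  then have "eventually (\<lambda>w. kurepa_ext w = kurepa_integral w) (nhds z)"
    by eventually_elim (simp add: kurepa_ext.simps)
  then show ?case
    using isCont_kurepa_integral[of z] 0 by (simp add: isCont_cong)
next
  case (Suc m)
  have "z + 1 \<notin> \<int>\<^sub>\<le>\<^sub>0"
  proof
    assume "z + 1 \<in> \<int>\<^sub>\<le>\<^sub>0"
    then obtain k where "z + 1 = of_int k" "k \<le> 0" by (auto elim: nonpos_Ints_cases)
    then have "z = of_int (k - 1)" "k - 1 < 0" by (auto simp: algebra_simps)
    then show False using Suc.prems(2) by blast
  qed
  moreover have "z + 1 \<notin> of_int ` {k. k < 0}"
    using calculation by (auto simp: nonpos_Ints_def)
  then have "isCont kurepa_ext (z + 1)"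
    using Suc.prems by (intro Suc.IH) auto
  then have "isCont (\<lambda>w. kurepa_ext (w + 1)) z"
    by (intro isCont_o2[of z "\<lambda>w. w + 1" kurepa_ext] continuous_intros)
  ultimately have "isCont (\<lambda>w. kurepa_ext (w + 1) - Gamma (w + 1)) z"
    by (intro continuous_intros) auto
  then show ?case by (simp add: kurepa_ext_plus_1)
qed

text \<open>By continuity the limit taken by \<open>remove_sings\<close> is the value
  itself.\<close>

lemma kurepa_eq_kurepa_ext:
  assumes "z \<notin> of_int ` {k. k < 0}"
  shows "kurepa z = kurepa_ext z"
proof -
  obtain m where "- Re z < real m" using reals_Archimedean2 by blast
  then have "isCont kurepa_ext z" using isCont_kurepa_ext_strip[of m z] assms by simp
  then show ?thesis unfolding kurepa_def by (intro remove_sings_eqI) (simp add: isCont_def)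
qed

lemma kurepa_ext_diff_of_nat:
  "kurepa_ext z = kurepa_ext (z - of_nat n) + (\<Sum>k<n. Gamma (z - of_nat k))"
proof (induction n)
  case (Suc n)
  have "kurepa_ext (z - of_nat n) = kurepa_ext (z - of_nat (Suc n)) + Gamma (z - of_nat n)"
    using kurepa_ext_plus_1[of "z - of_nat (Suc n)"] by simp
  then show ?case using Suc by simp
qed simp

section \<open>The rational functions\<close>

text \<open>The constant \<open>1\<close> solves the common recurrence, since its two coefficients
  sum to \<open>1\<close>.\<close>

lemma kurepa_Q_eq:
  assumes "\<And>k. k < n \<Longrightarrow> z \<noteq> of_nat k"
  shows "kurepa_Q n z = kurepa_R n z + 1"
  using assms
proof (induction n z rule: kurepa_Q.induct)
  case (4 m z)
  have "z - of_nat (Suc (Suc m)) \<noteq> 0" using "4.prems"[of "Suc (Suc m)"] by simp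
  moreover have "kurepa_Q (Suc (Suc m)) z = kurepa_R (Suc (Suc m)) z + 1"
    "kurepa_Q (Suc m) z = kurepa_R (Suc m) z + 1"
    using 4 by auto
  ultimately show ?case by (simp add: Let_def divide_simps) (simp add: algebra_simps)
next
  case (2 z)
  then show ?case by (simp add: field_simps)
next
  case (3 z)
  then have "z - 1 \<noteq> 0" by force
  then show ?case by (simp add: field_simps)
qed simp

text \<open>At the negative integers both sides are the junk value \<open>0\<close> of \<open>Gamma\<close> at its poles.\<close>

lemma Gamma_plus1_nonzero:
  fixes z :: complex
  assumes "z \<noteq> 0"
  shows "Gamma (z + 1) = z * Gamma z"
proof (cases "z \<in> \<int>\<^sub>\<le>\<^sub>0")
  case True
  then obtain k where k: "z = of_int k" "k \<le> 0" by (auto elim: nonpos_Ints_cases)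
  with assms have "k + 1 \<le> 0" by auto
  then have "of_int (k + 1) \<in> (\<int>\<^sub>\<le>\<^sub>0 :: complex set)" by (rule nonpos_Ints_of_int)
  then have "z + 1 \<in> \<int>\<^sub>\<le>\<^sub>0" using k by simp
  with True have "Gamma z = 0" "Gamma (z + 1) = 0" by (simp_all only: Gamma_eq_zero_iff)
  then show ?thesis by simp
qed (rule Gamma_plus1)

text \<open>With \<open>w = z - (n + 1)\<close> the recurrence reads
  \<open>w * (R (n+2) - R (n+1)) = R (n+1) - R n\<close>, matching
  \<open>Gamma (w + 1) = w * Gamma w\<close>. The product form avoids dividing by
  \<open>Gamma (z + 1)\<close>.\<close>

lemma kurepa_R_diff:
  assumes "\<And>k. k \<le> n \<Longrightarrow> z \<noteq> of_nat k"
  shows "(kurepa_R (Suc n) z - kurepa_R n z) * Gamma (z + 1) = Gamma (z - of_nat n)"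
  using assms
proof (induction n)
  case 0
  then show ?case using Gamma_plus1_nonzero[of z] by (auto simp: field_simps)
next
  case (Suc n)
  define w where "w = z - of_nat (Suc n)"
  have w: "w \<noteq> 0" using Suc.prems[of "Suc n"] by (simp add: w_def)
  have "w * (kurepa_R (Suc (Suc n)) z - kurepa_R (Suc n) z) = kurepa_R (Suc n) z - kurepa_R n z"
  \<comment> \<open>\<open>kurepa_R\<close> at index 2 has its own clause; the value
    \<open>0\<close> at index 0 makes it fit the recurrence.\<close>
  proof (cases n)
    case 0
    have "z \<noteq> 0" using Suc.prems[of 0] by simp
    then show ?thesis using w 0 by (simp add: w_def field_simps)
  next
    case (Suc m)
    show ?thesis using w unfolding w_def Suc
      by (simp add: Let_def divide_simps) (simp add: algebra_simps)
  qed
  then have "w * ((kurepa_R (Suc (Suc n)) z - kurepa_R (Suc n) z) * Gamma (z + 1)) = Gamma (w + 1)"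
    using Suc.IH Suc.prems by (simp add: w_def mult.assoc [symmetric])
  moreover have "Gamma (w + 1) = w * Gamma w" using w by (rule Gamma_plus1_nonzero)
  ultimately show ?case using w by (simp add: w_def)
qed

theorem theorem3p3:
  fixes n :: nat and z :: complex
  assumes "n \<ge> 1"
    and "z \<notin> of_int ` {k. k < 0} \<union> of_nat ` {0..<n}"
  shows "kurepa z = kurepa (z - of_nat n) + (kurepa_Q n z - 1) * Gamma (z + 1)
       \<and> kurepa z = kurepa (z - of_nat n) + kurepa_R n z * Gamma (z + 1)"
proof -
  have z: "z \<noteq> of_nat k" if "k < n" for k using assms(2) that by auto
  \<comment> \<open>Otherwise \<open>z\<close> would be an integer below \<open>n\<close>, hence
    negative or one of \<open>0, ..., n - 1\<close>.\<close>
  have "z - of_nat n \<notin> of_int ` {k. k < 0}"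
  proof
    assume "z - of_nat n \<in> of_int ` {k. k < 0}"
    then obtain k where k: "z - of_nat n = of_int k" "k < 0" by auto
    define j where "j = k + int n"
    have zj: "z = of_int j" using k by (simp add: j_def algebra_simps)
    show False
    proof (cases "j < 0")
      case True
      then show False using zj assms(2) by blast
    next
      case False
      then have "z = of_nat (nat j)" "nat j < n" using zj k by (auto simp: j_def)
      then show False using z by blast
    qed
  qed
  moreover have "z \<notin> of_int ` {k. k < 0}" using assms(2) by blast
  ultimately have "kurepa z = kurepa (z - of_nat n) + (\<Sum>k<n. Gamma (z - of_nat k))"
    using kurepa_ext_diff_of_nat[of z n] by (simp add: kurepa_eq_kurepa_ext)
  \<comment> \<open>The sum becomes telescoping and, as \<open>kurepa_R 0 z = 0\<close>, only the
    term at \<open>n\<close> survives.\<close>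
  also have "(\<Sum>k<n. Gamma (z - of_nat k))
      = (\<Sum>k<n. (kurepa_R (Suc k) z - kurepa_R k z) * Gamma (z + 1))"
    using z by (intro sum.cong refl kurepa_R_diff [symmetric]) auto
  also have "\<dots> = (kurepa_R n z - kurepa_R 0 z) * Gamma (z + 1)"
    by (simp only: sum_distrib_right [symmetric]
        sum_lessThan_telescope[where f = "\<lambda>k. kurepa_R k z"])
  also have "\<dots> = kurepa_R n z * Gamma (z + 1)" by simp
  finally show ?thesis using z by (simp add: kurepa_Q_eq)
qed

end
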